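(* Let $f:\mathbb R^d\to\mathbb R$ be convex and $L_{p,\nu}$-Hölder continuous of $p$-th order, with $p\in\{2,3\}$, $\nu\in[0,1]$, $q=p+\nu$, $M_q=L_{p,\nu}$, and with $\gamma$-bounded Hessian change along the iterates. Then algorithm RN has a superlinear local convergence rate, $$\|\nabla f(x^{k+1})\|_{x^{k+1}}^{*}\ \le\ \frac{2}{\gamma}\,(9M_q)^{\frac1{q-1}}\big(\|\nabla f(x^k)\|_{x^k}^{*}\big)^{2-\frac1{q-1}} .$$
   Context: $f$ is twice differentiable with positive definite Hessian at every point. Local norms: $\|h\|_x=\langle\nabla^2 f(x)h,h\rangle^{1/2}$, $\|g\|_x^*=\langle g,[\nabla^2 f(x)]^{-1}g\rangle^{1/2}$. $f$ is $L_{p,\nu}$-Hölder continuous of $p$-th order if it is $p$ times differentiable, $L_{p,\nu}<\infty$, and $\|\nabla^p f(x)-\nabla^p f(y)\|_{op}\le L_{p,\nu}\|x-y\|_x^{\nu}$ for all $x,y\in\mathbb R^d$, where $\|A\|_{op}=\sup\{|A[h_1,\dots,h_p]|:\|h_i\|_x\le1\}$. Algorithm RN (parameters $q\in[2,4]$, $M_q<\infty$, starting point $x^0$): $x^{k+1}=x^k-\alpha_k[\nabla^2 f(x^k)]^{-1}\nabla f(x^k)$ with $\alpha_k=\frac1{1+\theta_k}$, $\theta_k=(9M_q)^{\frac1{q-1}}\big(\|\nabla f(x^k)\|_{x^k}^*\big)^{\frac{q-2}{q-1}}$. $\gamma$-bounded Hessian change: $\gamma>0$ is a constant with $\gamma\le\dfrac{(\|\nabla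 f(x^{k+1})\|_{x^k}^* )^2}{(\|\nabla f(x^{k+1})\|_{x^{k+1}}^* )^2}$ for consecutive iterates. *)

theory Defs
  imports "HOL-Analysis.Analysis"
begin

definition gradient :: "(real ^ 'n \<Rightarrow> real) \<Rightarrow> real ^ 'n \<Rightarrow> real ^ 'n" where
  "gradient f x = (THE g. GDERIV f x :> g)"

definition hessian :: "(real ^ 'n \<Rightarrow> real) \<Rightarrow> real ^ 'n \<Rightarrow> real ^ 'n ^ 'n" where
  "hessian f x = jacobian (gradient f) (at x)"

(* Symmetry is not demanded: it is automatic for Hessians of twice differentiable functions. *)
definition positive_definite :: "real ^ 'n ^ 'n \<Rightarrow> bool" where
  "positive_definite A \<longleftrightarrow> (\<forall>v. v \<noteq> 0 \<longrightarrow> v \<bullet> (A *v v) > 0)"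

(* iter_deriv f [h1, ..., hp] x is the p-th Frechet derivative of f at x, evaluated on the
   directions h1, ..., hp.  In finite dimension the (p-1)-st derivative, as a map into multilinear
   forms, is differentiable iff all its evaluations on fixed directions are; so
   times_differentiable is p-fold Frechet differentiability on the whole space. *)
primrec iter_deriv :: "(real ^ 'n \<Rightarrow> real) \<Rightarrow> (real ^ 'n) list \<Rightarrow> real ^ 'n \<Rightarrow> real" where
  "iter_deriv f [] = f"
| "iter_deriv f (h # hs) = (\<lambda>x. frechet_derivative (iter_deriv f hs) (at x) h)"

definition times_differentiable :: "nat \<Rightarrow> (real ^ 'n \<Rightarrow> real) \<Rightarrow> bool" where
  "times_differentiable p f \<longleftrightarrow>
     (\<forall>hs. length hs < p \<longrightarrow> (\<forall>x. iter_deriv f hs differentiable (at x)))"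

definition local_norm :: "(real ^ 'n \<Rightarrow> real) \<Rightarrow> real ^ 'n \<Rightarrow> real ^ 'n \<Rightarrow> real" where
  "local_norm f x h = sqrt ((hessian f x *v h) \<bullet> h)"

definition dual_norm :: "(real ^ 'n \<Rightarrow> real) \<Rightarrow> real ^ 'n \<Rightarrow> real ^ 'n \<Rightarrow> real" where
  "dual_norm f x g = sqrt (g \<bullet> (matrix_inv (hessian f x) *v g))"

(* The p-linear form A takes its arguments as a list of length p.  For multilinear A and positive
   definite Hessian the set under the supremum is bounded; it is nonempty (all arguments zero). *)
definition op_norm ::
    "(real ^ 'n \<Rightarrow> real) \<Rightarrow> real ^ 'n \<Rightarrow> nat \<Rightarrow> ((real ^ 'n) list \<Rightarrow> real) \<Rightarrow> real" where
  "op_norm f x p A =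
     (SUP hs \<in> {hs. length hs = p \<and> (\<forall>h \<in> set hs. local_norm f x h \<le> 1)}. \<bar>A hs\<bar>)"

(* Since 0 powr 0 = 0, the case x = y with \<nu> = 0 reads 0 \<le> 0, which holds anyway. *)
definition holder_continuous :: "nat \<Rightarrow> real \<Rightarrow> real \<Rightarrow> (real ^ 'n \<Rightarrow> real) \<Rightarrow> bool" where
  "holder_continuous p \<nu> L f \<longleftrightarrow>
     times_differentiable p f \<and>
     (\<forall>x y. op_norm f x p (\<lambda>hs. iter_deriv f hs x - iter_deriv f hs y)
             \<le> L * local_norm f x (x - y) powr \<nu>)"

(* The convention 0 powr 0 = 0 matters here only when the gradient at x vanishes (and q = 2);
   then the step of the algorithm is zero whatever the value of \<theta>. *)
definition RN_theta :: "real \<Rightarrow> real \<Rightarrow> (real ^ 'n \<Rightarrow> real) \<Rightarrow> real ^ 'n \<Rightarrow> real" where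
  "RN_theta q M f x =
     (9 * M) powr (1 / (q - 1)) * dual_norm f x (gradient f x) powr ((q - 2) / (q - 1))"

definition RN_alpha :: "real \<Rightarrow> real \<Rightarrow> (real ^ 'n \<Rightarrow> real) \<Rightarrow> real ^ 'n \<Rightarrow> real" where
  "RN_alpha q M f x = 1 / (1 + RN_theta q M f x)"

primrec RN :: "real \<Rightarrow> real \<Rightarrow> (real ^ 'n \<Rightarrow> real) \<Rightarrow> real ^ 'n \<Rightarrow> nat \<Rightarrow> real ^ 'n" where
  "RN q M f x0 0 = x0"
| "RN q M f x0 (Suc k) =
     RN q M f x0 k - RN_alpha q M f (RN q M f x0 k) *\<^sub>R
       (matrix_inv (hessian f (RN q M f x0 k)) *v gradient f (RN q M f x0 k))"

(* The quotient is undefined (0 / 0) once an iterate is a stationary point, and Isabelle's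
   0 / 0 = 0 would make the condition unsatisfiable there; hence the guard. *)
definition bounded_hessian_change ::
    "real \<Rightarrow> (real ^ 'n \<Rightarrow> real) \<Rightarrow> (nat \<Rightarrow> real ^ 'n) \<Rightarrow> bool" where
  "bounded_hessian_change \<gamma> f x \<longleftrightarrow>
     \<gamma> > 0 \<and>
     (\<forall>k. gradient f (x (Suc k)) \<noteq> 0 \<longrightarrow>
        \<gamma> \<le> (dual_norm f (x k) (gradient f (x (Suc k))))\<^sup>2
             / (dual_norm f (x (Suc k)) (gradient f (x (Suc k))))\<^sup>2)"

end

theory Submission
  imports Defs
begin

text \<open>
  Write \<open>H y\<close> for the Hessian of \<open>f\<close> at \<open>y\<close>, and fix an iterate \<open>x\<close> with next iterate \<open>x + d\<close>. Put
  \<open>G = dual_norm f x (gradient f x)\<close>; then \<open>local_norm f x d = G / (1 + \<theta>)\<close>, where \<open>\<theta>\<close> is the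
  damping of the step. Everything rests on one estimate: along the whole step the Hessian differs
  from \<open>H x\<close>, as a bilinear form and measured in the local norm at \<open>x\<close>, by at most \<open>\<theta>\<close>.

  This estimate has two consequences (\<open>damped_newton_step\<close>). By the mean value theorem the new
  gradient is \<open>\<theta> / (1 + \<theta>)\<close> times the old one, up to an error of dual norm at most
  \<open>\<theta> * G / (1 + \<theta>)\<close>; so its dual norm at \<open>x\<close> is at most \<open>2 * \<theta> * G / (1 + \<theta>)\<close>. Moreover
  \<open>H (x + d) \<le> (1 + \<theta>) * H x\<close>, so passing from the dual norm at \<open>x + d\<close> to the
  one at \<open>x\<close> costs at most a factor \<open>1 + \<theta>\<close>. If \<open>a\<close> and \<open>b\<close> are the dual norms of the new gradient at \<open>x\<close> and at \<open>x + d\<close>, then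
  \<open>\<gamma> \<le> a\<^sup>2 / b\<^sup>2\<close> yields \<open>\<gamma> * b \<le> a * (a / b) \<le> 2 * \<theta> * G\<close>, which is the claim. The bound
  \<open>a / b \<le> 1 + \<theta>\<close> is what makes the factor \<open>1 / \<gamma>\<close>, instead of the \<open>1 / sqrt \<gamma>\<close> that
  \<open>b \<le> a / sqrt \<gamma>\<close> would give, correct also for \<open>\<gamma> > 1\<close>.

  For \<open>p = 2\<close> the estimate on the Hessian is the Hoelder condition together with the choice of \<open>\<theta>\<close>.
  For \<open>p = 3\<close> the change of the Hessian is the third derivative at \<open>x\<close> plus a Hoelder remainder,
  and the third derivative itself has to be bounded (\<open>third_derivative_bound\<close>): since the Hessian
  stays positive at \<open>x + h\<close> and \<open>x - h\<close>, neither sign of the third derivative in direction \<open>h\<close> can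
  exceed \<open>H x\<close> plus the remainder. Rescaling \<open>h\<close> optimises this bound, and the definition of \<open>\<theta>\<close>
  turns each term into a fraction of \<open>\<theta>\<close> (\<open>damped_radius_third_order\<close>).

  Two facts of calculus are needed on the way. Second derivatives are symmetric as soon as they
  exist in the sense of Frechet (\<open>second_derivative_symmetric\<close>). And the supremum in \<open>op_norm\<close> is
  taken over a bounded set, so that it really bounds the values of the form (\<open>op_norm_bound\<close>).
\<close>

section \<open>Symmetry of the second derivative\<close>

lemma line_mean_value:
  fixes g :: "'a::real_normed_vector \<Rightarrow> real"
  assumes "\<And>y. g differentiable (at y)"
  obtains \<xi> where "0 < \<xi>" "\<xi> < 1"
    and "g (x + h) - g x = frechet_derivative g (at (x + \<xi> *\<^sub>R h)) h"
proof -
  have "((\<lambda>t. g (x + t *\<^sub>R h)) has_derivative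
          (\<lambda>s. frechet_derivative g (at (x + t *\<^sub>R h)) (s *\<^sub>R h))) (at t within {0..1})" for t
  proof -
    have "(g has_derivative frechet_derivative g (at (x + t *\<^sub>R h))) (at (x + t *\<^sub>R h))"
      using assms frechet_derivative_works by blast
    moreover have "((\<lambda>t. x + t *\<^sub>R h) has_derivative (\<lambda>s. s *\<^sub>R h)) (at t within {0..1})"
      by (auto intro!: derivative_eq_intros)
    ultimately show ?thesis
      by (rule has_derivative_compose[rotated])
  qed
  then obtain \<xi> where "\<xi> \<in> {0<..<1::real}"
    "g (x + 1 *\<^sub>R h) - g (x + 0 *\<^sub>R h)
      = frechet_derivative g (at (x + \<xi> *\<^sub>R h)) ((1 - 0) *\<^sub>R h)"
    using mvt_simple[of 0 1 "\<lambda>t. g (x + t *\<^sub>R h)"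
        "\<lambda>t s. frechet_derivative g (at (x + t *\<^sub>R h)) (s *\<^sub>R h)"] by auto
  then show thesis
    by (intro that[of \<xi>]) auto
qed

lemma iter_deriv_differentiable:
  "times_differentiable p f \<Longrightarrow> length hs < p \<Longrightarrow> iter_deriv f hs differentiable (at y)"
  unfolding times_differentiable_def by blast

lemma times_differentiable_mono:
  "times_differentiable p f \<Longrightarrow> q \<le> p \<Longrightarrow> times_differentiable q f"
  unfolding times_differentiable_def by auto

text \<open>
  The second difference is symmetric in \<open>u\<close> and \<open>v\<close>, the iterated derivative a priori is not;
  comparing them for both orders gives symmetry. The mean value theorem is applied to
  \<open>y \<mapsto> f (y + t *\<^sub>R v) - f y\<close> along \<open>u\<close>, and the two first derivatives that
  appear are expanded around \<open>x\<close>, so that pointwise differentiability suffices.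
\<close>

lemma second_difference_quotient:
  assumes diff: "times_differentiable 2 f" and "e > 0"
  shows "\<exists>d>0. \<forall>t. 0 < t \<and> t < d \<longrightarrow>
    \<bar>f (x + t *\<^sub>R u + t *\<^sub>R v) - f (x + t *\<^sub>R u) - f (x + t *\<^sub>R v) + f x
       - t\<^sup>2 * iter_deriv f [v, u] x\<bar> \<le> e * t\<^sup>2 * (2 * norm u + norm v)"
proof -
  let ?D = "\<lambda>y. iter_deriv f [u] y"
  let ?L = "frechet_derivative ?D (at x)"
  have f_diff: "f differentiable (at y)" for y
    using iter_deriv_differentiable[OF diff, of "[]"] by simp
  have D: "(?D has_derivative ?L) (at x)"
    using iter_deriv_differentiable[OF diff, of "[u]"] frechet_derivative_works by auto
  then have lin: "linear ?L"
    by (simp add: bounded_linear.linear has_derivative_bounded_linear)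
  obtain d0 where "d0 > 0"
    and d0: "\<And>y. norm (y - x) < d0 \<Longrightarrow> \<bar>?D y - ?D x - ?L (y - x)\<bar> \<le> e * norm (y - x)"
    using D \<open>e > 0\<close> unfolding has_derivative_at_alt by (metis real_norm_def)
  \<comment> \<open>keeps both points at which the first derivative is evaluated within \<open>d0\<close> of \<open>x\<close>\<close>
  let ?C = "norm u + norm v + 1"
  have "\<bar>f (x + t *\<^sub>R u + t *\<^sub>R v) - f (x + t *\<^sub>R u) - f (x + t *\<^sub>R v) + f x
       - t\<^sup>2 * iter_deriv f [v, u] x\<bar> \<le> e * t\<^sup>2 * (2 * norm u + norm v)"
    if t: "0 < t" "t < d0 / ?C" for t
  proof -
    let ?g = "\<lambda>y. f (y + t *\<^sub>R v) - f y"
    have g: "(?g has_derivative (\<lambda>h. frechet_derivative f (at (y + t *\<^sub>R v)) h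
               - frechet_derivative f (at y) h)) (at y)" for y
    proof -
      have "(f has_derivative frechet_derivative f (at (y + t *\<^sub>R v))) (at (y + t *\<^sub>R v))"
        using f_diff frechet_derivative_works by blast
      moreover have "((\<lambda>y. y + t *\<^sub>R v) has_derivative (\<lambda>h. h)) (at y)"
        by (auto intro!: derivative_eq_intros)
      ultimately have "((\<lambda>y. f (y + t *\<^sub>R v)) has_derivative
          frechet_derivative f (at (y + t *\<^sub>R v))) (at y)"
        by (rule has_derivative_compose[rotated])
      then show ?thesis
        using f_diff frechet_derivative_works has_derivative_diff by blast
    qed
    then have "\<And>y. ?g differentiable (at y)"
      unfolding differentiable_def by blast
    from line_mean_value[OF this, of x "t *\<^sub>R u"] obtain \<xi> where \<xi>: "0 < \<xi>" "\<xi> < 1"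
      and mv: "?g (x + t *\<^sub>R u) - ?g x
          = frechet_derivative ?g (at (x + \<xi> *\<^sub>R t *\<^sub>R u)) (t *\<^sub>R u)"
      by blast
    let ?y = "x + \<xi> *\<^sub>R t *\<^sub>R u"
    have "frechet_derivative ?g (at ?y) (t *\<^sub>R u)
        = frechet_derivative f (at (?y + t *\<^sub>R v)) (t *\<^sub>R u)
          - frechet_derivative f (at ?y) (t *\<^sub>R u)"
      by (simp only: frechet_derivative_at[OF g[of ?y], symmetric])
    also have "\<dots> = t * (?D (?y + t *\<^sub>R v) - ?D ?y)"
      using linear_frechet_derivative[OF f_diff]
      by (simp add: linear_cmul right_diff_distrib)
    finally have eq: "?g (x + t *\<^sub>R u) - ?g x = t * (?D (?y + t *\<^sub>R v) - ?D ?y)"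
      using mv by simp
    have small: "t * norm u + t * norm v < d0"
    proof -
      have "t * ?C < d0"
        using t by (simp add: pos_less_divide_eq add_pos_nonneg add_nonneg_pos)
      then show ?thesis
        using t by (simp add: algebra_simps)
    qed
    have n1: "norm (?y - x) \<le> t * norm u"
      using \<xi> t by (simp add: mult_left_le_one_le)
    have n2: "norm (?y + t *\<^sub>R v - x) \<le> t * norm u + t * norm v"
    proof -
      have "norm (\<xi> *\<^sub>R t *\<^sub>R u + t *\<^sub>R v) \<le> norm (\<xi> *\<^sub>R t *\<^sub>R u) + norm (t *\<^sub>R v)"
        by (rule norm_triangle_ineq)
      then show ?thesis
        using n1 t by (simp add: algebra_simps)
    qed
    have a1: "\<bar>?D ?y - ?D x - ?L (?y - x)\<bar> \<le> e * (t * norm u)"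
    proof -
      have "norm (?y - x) < d0"
        using n1 small t by (smt (verit) mult_nonneg_nonneg norm_ge_zero)
      from d0[OF this] show ?thesis
        using mult_left_mono[OF n1, of e] \<open>e > 0\<close> by linarith
    qed
    have a2: "\<bar>?D (?y + t *\<^sub>R v) - ?D x - ?L (?y + t *\<^sub>R v - x)\<bar> \<le> e * (t * norm u + t * norm v)"
      using d0[OF le_less_trans[OF n2 small]] mult_left_mono[OF n2, of e] \<open>e > 0\<close> by linarith
    have "?L (?y + t *\<^sub>R v - x) - ?L (?y - x) = t * iter_deriv f [v, u] x"
      using lin by (simp add: linear_diff[symmetric] linear_add linear_cmul)
    then have "\<bar>?D (?y + t *\<^sub>R v) - ?D ?y - t * iter_deriv f [v, u] x\<bar>
        \<le> e * t * (2 * norm u + norm v)"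
      using a1 a2 by (simp add: algebra_simps)
    then have "t * \<bar>?D (?y + t *\<^sub>R v) - ?D ?y - t * iter_deriv f [v, u] x\<bar>
        \<le> t * (e * t * (2 * norm u + norm v))"
      using t by (simp add: mult_left_mono)
    moreover have "t * \<bar>?D (?y + t *\<^sub>R v) - ?D ?y - t * iter_deriv f [v, u] x\<bar>
        = \<bar>?g (x + t *\<^sub>R u) - ?g x - t\<^sup>2 * iter_deriv f [v, u] x\<bar>"
      unfolding eq using t by (simp add: abs_mult_pos' power2_eq_square algebra_simps)
    ultimately show ?thesis
      by (simp add: power2_eq_square algebra_simps)
  qed
  moreover have "0 < d0 / ?C"
    using \<open>d0 > 0\<close> by (simp add: add_nonneg_pos)
  ultimately show ?thesis
    by blast
qed

lemma second_derivative_symmetric: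
  assumes "times_differentiable 2 f"
  shows "iter_deriv f [u, v] x = iter_deriv f [v, u] x"
proof -
  let ?C = "3 * (norm u + norm v)"
  have bound: "\<bar>iter_deriv f [u, v] x - iter_deriv f [v, u] x\<bar> \<le> e * ?C" if e: "e > 0" for e
  proof -
    obtain d1 where d1: "d1 > 0" "\<forall>t. 0 < t \<and> t < d1 \<longrightarrow>
      \<bar>f (x + t *\<^sub>R u + t *\<^sub>R v) - f (x + t *\<^sub>R u) - f (x + t *\<^sub>R v) + f x
       - t\<^sup>2 * iter_deriv f [v, u] x\<bar> \<le> e * t\<^sup>2 * (2 * norm u + norm v)"
      using second_difference_quotient[OF assms e] by blast
    obtain d2 where d2: "d2 > 0" "\<forall>t. 0 < t \<and> t < d2 \<longrightarrow>
      \<bar>f (x + t *\<^sub>R v + t *\<^sub>R u) - f (x + t *\<^sub>R v) - f (x + t *\<^sub>R u) + f x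
       - t\<^sup>2 * iter_deriv f [u, v] x\<bar> \<le> e * t\<^sup>2 * (2 * norm v + norm u)"
      using second_difference_quotient[OF assms e] by blast
    define t where "t = min d1 d2 / 2"
    have t: "0 < t" "t < d1" "t < d2"
      using d1(1) d2(1) by (auto simp: t_def)
    have "x + t *\<^sub>R v + t *\<^sub>R u = x + t *\<^sub>R u + t *\<^sub>R v"
      by simp
    then have "\<bar>t\<^sup>2 * iter_deriv f [u, v] x - t\<^sup>2 * iter_deriv f [v, u] x\<bar>
        \<le> e * t\<^sup>2 * (2 * norm u + norm v) + e * t\<^sup>2 * (2 * norm v + norm u)"
      using d1(2)[rule_format, of t] d2(2)[rule_format, of t] t by (smt (verit))
    also have "\<dots> = t\<^sup>2 * (e * ?C)"
      by (simp add: algebra_simps)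
    finally have "t\<^sup>2 * \<bar>iter_deriv f [u, v] x - iter_deriv f [v, u] x\<bar> \<le> t\<^sup>2 * (e * ?C)"
      by (simp only: right_diff_distrib[symmetric] abs_mult) simp
    then show ?thesis
      using t by (simp add: mult_le_cancel_left_pos)
  qed
  have "\<bar>iter_deriv f [u, v] x - iter_deriv f [v, u] x\<bar> \<le> 0 + e" if "e > 0" for e
  proof -
    have pos: "?C + 1 > 0"
      by (simp add: add_nonneg_pos)
    have "\<bar>iter_deriv f [u, v] x - iter_deriv f [v, u] x\<bar> \<le> e / (?C + 1) * ?C"
      using that pos by (intro bound) (simp add: divide_pos_pos)
    also have "\<dots> \<le> e"
      using that pos by (simp add: field_simps)
    finally show ?thesis
      by simp
  qed
  then have "\<bar>iter_deriv f [u, v] x - iter_deriv f [v, u] x\<bar> \<le> 0"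
    by (rule field_le_epsilon)
  then show ?thesis
    by simp
qed

section \<open>Multilinear forms on lists of vectors\<close>

text \<open>
  Linearity is required in the head of the list only, and then recursively in the tail. This
  covers every position, and it matches the recursion of \<open>iter_deriv\<close>, whose head is the direction
  of the outermost derivative.
\<close>

primrec multilinear_form :: "nat \<Rightarrow> ('a::real_vector list \<Rightarrow> real) \<Rightarrow> bool" where
  "multilinear_form 0 A \<longleftrightarrow> True"
| "multilinear_form (Suc p) A \<longleftrightarrow>
     (\<forall>hs. length hs = p \<longrightarrow> linear (\<lambda>h. A (h # hs))) \<and> (\<forall>h. multilinear_form p (\<lambda>hs. A (h # hs)))"

lemma multilinear_form_diff:
  "multilinear_form p A \<Longrightarrow> multilinear_form p B \<Longrightarrow> multilinear_form p (\<lambda>hs. A hs - B hs)"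
  by (induction p arbitrary: A B) (auto intro: linear_compose_sub)

text \<open>
  This is the induction step for \<open>multilinear_form_iter_deriv\<close>: differentiation is linear, so the
  derivative of a family of functions inherits multilinear dependence on the parameters \<open>hs\<close>.
\<close>

lemma multilinear_form_frechet_derivative:
  assumes "\<And>y. multilinear_form p (\<lambda>hs. F hs y)"
    and "\<And>hs. length hs = p \<Longrightarrow> F hs differentiable (at x)"
  shows "multilinear_form p (\<lambda>hs. frechet_derivative (F hs) (at x) h)"
  using assms
proof (induction p arbitrary: F)
  case (Suc p)
  have "linear (\<lambda>k. frechet_derivative (F (k # hs)) (at x) h)" if len: "length hs = p" for hs
  proof -
    have lin: "linear (\<lambda>k. F (k # hs) y)" for y
      using Suc.prems(1)[of y] len by simp
    have der: "(F (k # hs) has_derivative frechet_derivative (F (k # hs)) (at x)) (at x)" for k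
      using Suc.prems(2)[of "k # hs"] len frechet_derivative_works by auto
    show ?thesis
    proof (rule linearI)
      fix k k' and c :: real
      have "F ((k + k') # hs) = (\<lambda>y. F (k # hs) y + F (k' # hs) y)"
        using linear_add[OF lin] by auto
      then have "(F ((k + k') # hs) has_derivative (\<lambda>h. frechet_derivative (F (k # hs)) (at x) h
          + frechet_derivative (F (k' # hs)) (at x) h)) (at x)"
        using has_derivative_add[OF der der] by simp
      from frechet_derivative_at[OF this, symmetric]
      show "frechet_derivative (F ((k + k') # hs)) (at x) h
        = frechet_derivative (F (k # hs)) (at x) h + frechet_derivative (F (k' # hs)) (at x) h"
        by simp
      have "F ((c *\<^sub>R k) # hs) = (\<lambda>y. c *\<^sub>R F (k # hs) y)"
        using linear_cmul[OF lin] by auto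
      then have "(F ((c *\<^sub>R k) # hs) has_derivative
          (\<lambda>h. c *\<^sub>R frechet_derivative (F (k # hs)) (at x) h)) (at x)"
        using has_derivative_scaleR_right[OF der] by simp
      from frechet_derivative_at[OF this, symmetric]
      show "frechet_derivative (F ((c *\<^sub>R k) # hs)) (at x) h
        = c *\<^sub>R frechet_derivative (F (k # hs)) (at x) h"
        by simp
    qed
  qed
  moreover have "multilinear_form p (\<lambda>hs. frechet_derivative (F (k # hs)) (at x) h)" for k
    using Suc.prems by (intro Suc.IH) auto
  ultimately show ?case
    by simp
qed simp

lemma multilinear_form_iter_deriv:
  "times_differentiable p f \<Longrightarrow> multilinear_form p (\<lambda>hs. iter_deriv f hs x)"
proof (induction p arbitrary: x)
  case (Suc p)
  have "multilinear_form p (\<lambda>hs. frechet_derivative (iter_deriv f hs) (at x) h)" for h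
    using Suc.prems
    by (intro multilinear_form_frechet_derivative Suc.IH)
      (auto intro: times_differentiable_mono iter_deriv_differentiable)
  moreover have "linear (\<lambda>h. iter_deriv f (h # hs) x)" if "length hs = p" for hs
    using linear_frechet_derivative[OF iter_deriv_differentiable[OF Suc.prems, of hs]] that by simp
  ultimately show ?case
    by simp
qed simp

text \<open>
  The factors \<open>c h\<close> and the vectors \<open>d h\<close> both depend on \<open>h\<close>, so that the arguments may be
  normalised: with \<open>d h\<close> the unit vector of \<open>h\<close> and \<open>c h\<close> its norm the left side is \<open>A hs\<close>.
\<close>

lemma multilinear_form_scale:
  "multilinear_form p A \<Longrightarrow> length hs = p \<Longrightarrow>
    A (map (\<lambda>h. c h *\<^sub>R d h) hs) = prod_list (map c hs) * A (map d hs)"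
proof (induction p arbitrary: A hs)
  case (Suc p)
  then obtain k ks where hs: "hs = k # ks" and len: "length ks = p"
    by (auto simp: length_Suc_conv)
  have "A (map (\<lambda>h. c h *\<^sub>R d h) hs) = c k * A (d k # map (\<lambda>h. c h *\<^sub>R d h) ks)"
    using Suc.prems len linear_cmul[of "\<lambda>h. A (h # map (\<lambda>h. c h *\<^sub>R d h) ks)"] by (simp add: hs)
  also have "A (d k # map (\<lambda>h. c h *\<^sub>R d h) ks) = prod_list (map c ks) * A (d k # map d ks)"
    using Suc.IH[of "\<lambda>hs. A (d k # hs)" ks] Suc.prems len by simp
  finally show ?case
    by (simp add: hs)
qed simp

lemma multilinear_form_bounded:
  fixes A :: "'a::euclidean_space list \<Rightarrow> real"
  assumes "multilinear_form p A"
  shows "\<exists>B\<ge>0. \<forall>hs. length hs = p \<longrightarrow> \<bar>A hs\<bar> \<le> B * prod_list (map norm hs)"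
  using assms
proof (induction p arbitrary: A)
  case 0
  show ?case
    by (intro exI[of _ "\<bar>A []\<bar>"]) auto
next
  case (Suc p)
  have "\<exists>B\<ge>0. \<forall>hs. length hs = p \<longrightarrow> \<bar>A (b # hs)\<bar> \<le> B * prod_list (map norm hs)" for b
    using Suc by simp
  then obtain B where B0: "\<And>b. B b \<ge> 0"
    and B: "\<And>b hs. length hs = p \<Longrightarrow> \<bar>A (b # hs)\<bar> \<le> B b * prod_list (map norm hs)"
    by metis
  have "\<bar>A hs\<bar> \<le> (\<Sum>b\<in>Basis. B b) * prod_list (map norm hs)" if len: "length hs = Suc p" for hs
  proof -
    obtain k ks where hs: "hs = k # ks" and ks: "length ks = p"
      using len by (auto simp: length_Suc_conv)
    have lin: "linear (\<lambda>h. A (h # ks))"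
      using Suc.prems ks by simp
    have P0: "0 \<le> prod_list (map norm ks)"
      by (induction ks) auto
    have "A (k # ks) = A ((\<Sum>b\<in>Basis. (k \<bullet> b) *\<^sub>R b) # ks)"
      by (simp add: euclidean_representation)
    also have "\<dots> = (\<Sum>b\<in>Basis. (k \<bullet> b) * A (b # ks))"
      using linear_sum[OF lin, of "\<lambda>b. (k \<bullet> b) *\<^sub>R b" Basis] linear_cmul[OF lin] by simp
    finally have "\<bar>A hs\<bar> \<le> (\<Sum>b\<in>Basis. \<bar>(k \<bullet> b) * A (b # ks)\<bar>)"
      by (simp add: hs)
    also have "\<dots> \<le> (\<Sum>b\<in>Basis. norm k * (B b * prod_list (map norm ks)))"
      unfolding abs_mult by (intro sum_mono mult_mono B ks Basis_le_norm) auto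
    also have "\<dots> = (\<Sum>b\<in>Basis. B b) * prod_list (map norm hs)"
      by (simp add: hs sum_distrib_left sum_distrib_right mult_ac)
    finally show ?thesis .
  qed
  moreover have "(\<Sum>b\<in>Basis. B b) \<ge> 0"
    by (simp add: B0 sum_nonneg)
  ultimately show ?case
    by blast
qed

section \<open>Polarization\<close>

text \<open>
  A symmetric form is controlled by its diagonal: \<open>4 * B u v = B (u + v) (u + v) - B (u - v) (u - v)\<close>
  and the parallelogram law for \<open>Q\<close> give the bound for unit vectors. With \<open>B = Q\<close> and \<open>c = 1\<close> this
  is the Cauchy--Schwarz inequality; for a third derivative in a fixed direction it yields the
  operator norm from the quadratic form.
\<close>

lemma symmetric_bilinear_bound:
  fixes B Q :: "'a::real_vector \<Rightarrow> 'a \<Rightarrow> real"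
  assumes B: "bilinear B" and sym: "\<And>u v. B u v = B v u"
    and Q: "bilinear Q" and pos: "\<And>v. v \<noteq> 0 \<Longrightarrow> Q v v > 0"
    and diag: "\<And>v. \<bar>B v v\<bar> \<le> c * Q v v"
  shows "\<bar>B u v\<bar> \<le> c * sqrt (Q u u) * sqrt (Q v v)"
proof (cases "u = 0 \<or> v = 0")
  case True
  then show ?thesis
    using bilinear_lzero[OF B] bilinear_rzero[OF B] bilinear_lzero[OF Q] by auto
next
  case False
  have mean: "\<bar>2 * B a b\<bar> \<le> c * (Q a a + Q b b)" for a b
  proof -
    have "4 * B a b = B (a + b) (a + b) - B (a - b) (a - b)"
      using sym[of a b]
      by (simp add: bilinear_ladd[OF B] bilinear_radd[OF B] bilinear_lsub[OF B] bilinear_rsub[OF B])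
    moreover have "c * Q (a + b) (a + b) + c * Q (a - b) (a - b) = 2 * (c * (Q a a + Q b b))"
      by (simp add: bilinear_ladd[OF Q] bilinear_radd[OF Q] bilinear_lsub[OF Q] bilinear_rsub[OF Q]
          algebra_simps)
    ultimately show ?thesis
      using diag[of "a + b"] diag[of "a - b"] by linarith
  qed
  define r s where "r = sqrt (Q u u)" and "s = sqrt (Q v v)"
  have rs: "r > 0" "s > 0" "Q u u = r\<^sup>2" "Q v v = s\<^sup>2"
    using False pos[of u] pos[of v] by (auto simp: r_def s_def)
  have "Q (u /\<^sub>R r) (u /\<^sub>R r) = 1" "Q (v /\<^sub>R s) (v /\<^sub>R s) = 1"
    using rs by (simp_all add: bilinear_lmul[OF Q] bilinear_rmul[OF Q] power2_eq_square field_simps)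
  then have "\<bar>2 * B (u /\<^sub>R r) (v /\<^sub>R s)\<bar> \<le> c * (1 + 1)"
    using mean[of "u /\<^sub>R r" "v /\<^sub>R s"] by simp
  moreover have "B (u /\<^sub>R r) (v /\<^sub>R s) = B u v / (r * s)"
    by (simp add: bilinear_lmul[OF B] bilinear_rmul[OF B] divide_inverse)
  ultimately have "\<bar>B u v\<bar> / (r * s) \<le> c"
    using rs by (simp add: abs_mult)
  then have "\<bar>B u v\<bar> \<le> c * (r * s)"
    using rs by (simp add: pos_divide_le_eq)
  then show ?thesis
    by (simp add: r_def s_def)
qed

section \<open>Local and dual norms\<close>

text \<open>
  From here on derivatives in given directions are treated as multilinear forms; unfolding them
  automatically would replace them by nested Frechet derivatives.
\<close>

declare iter_deriv.simps(2) [simp del]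

locale hessian_metric =
  fixes f :: "real ^ 'n \<Rightarrow> real"
  assumes twice_differentiable: "times_differentiable 2 f"
    and hessian_positive: "\<And>z. positive_definite (hessian f z)"
begin

abbreviation D2 :: "real ^ 'n \<Rightarrow> real ^ 'n \<Rightarrow> real ^ 'n \<Rightarrow> real" where
  "D2 y u v \<equiv> iter_deriv f [u, v] y"

text \<open>
  In coordinates the gradient is \<open>\<Sum>b\<in>Basis. D b *\<^sub>R b\<close> for the Frechet derivative \<open>D\<close>.
\<close>

lemma gradient_inner: "gradient f y \<bullet> v = iter_deriv f [v] y"
proof -
  let ?D = "frechet_derivative f (at y)"
  have der: "(f has_derivative ?D) (at y)"
    using iter_deriv_differentiable[OF twice_differentiable, of "[]" y]
    by (simp add: frechet_derivative_works)
  then have lin: "linear ?D"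
    by (simp add: bounded_linear.linear has_derivative_bounded_linear)
  define g where "g = (\<Sum>b\<in>Basis. ?D b *\<^sub>R b)"
  have g: "?D h = h \<bullet> g" for h
  proof -
    have "?D h = ?D (\<Sum>b\<in>Basis. (h \<bullet> b) *\<^sub>R b)"
      by (simp add: euclidean_representation)
    also have "\<dots> = (\<Sum>b\<in>Basis. (h \<bullet> b) * ?D b)"
      using linear_sum[OF lin, of "\<lambda>b. (h \<bullet> b) *\<^sub>R b" Basis] linear_cmul[OF lin] by simp
    also have "\<dots> = h \<bullet> g"
      by (simp add: g_def inner_sum_right mult.commute)
    finally show ?thesis .
  qed
  have "?D = (\<lambda>h. h \<bullet> g)"
    using g by auto
  then have "GDERIV f y :> g"
    using der by (simp add: gderiv_def)
  moreover have "g' = g" if "GDERIV f y :> g'" for g'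
  proof -
    have "(\<lambda>h. h \<bullet> g') = ?D"
      using that frechet_derivative_at unfolding gderiv_def by blast
    then show ?thesis
      using g by (metis vector_eq_ldot)
  qed
  ultimately have "gradient f y = g"
    unfolding gradient_def by (rule the_equality)
  then show ?thesis
    by (simp add: g inner_commute iter_deriv.simps(2))
qed

lemma hessian_inner: "(hessian f y *v u) \<bullet> v = D2 y u v"
proof -
  have "gradient f differentiable (at y)"
    by (rule differentiable_componentwise_within[THEN iffD2])
      (simp add: gradient_inner iter_deriv_differentiable[OF twice_differentiable])
  then have "(gradient f has_derivative (\<lambda>h. hessian f y *v h)) (at y)"
    unfolding hessian_def by (simp only: jacobian_works)
  then have "((\<lambda>y. gradient f y \<bullet> v) has_derivative (\<lambda>h. (hessian f y *v h) \<bullet> v)) (at y)"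
    by (rule has_derivative_inner_left)
  then have "(iter_deriv f [v] has_derivative (\<lambda>h. (hessian f y *v h) \<bullet> v)) (at y)"
    by (simp only: gradient_inner)
  then have "(\<lambda>h. (hessian f y *v h) \<bullet> v) = frechet_derivative (iter_deriv f [v]) (at y)"
    by (rule frechet_derivative_at)
  then show ?thesis
    unfolding iter_deriv.simps(2) by (rule fun_cong)
qed

lemma D2_symmetric: "D2 y u v = D2 y v u"
  by (rule second_derivative_symmetric[OF twice_differentiable])

lemma bilinear_D2: "bilinear (D2 y)"
  unfolding bilinear_def hessian_inner[symmetric] linear_iff
  by (auto simp: matrix_vector_right_distrib inner_add_left inner_add_right
      matrix_vector_mult_scaleR)

lemma D2_positive: "v \<noteq> 0 \<Longrightarrow> D2 y v v > 0"
  using hessian_positive[of y] unfolding positive_definite_def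
  by (metis hessian_inner inner_commute)

lemma D2_nonneg: "D2 y v v \<ge> 0"
  using D2_positive[of v y] bilinear_lzero[OF bilinear_D2] by (cases "v = 0") auto

lemma local_norm_D2: "local_norm f y h = sqrt (D2 y h h)"
  by (simp only: local_norm_def hessian_inner)

lemma local_norm_power2: "(local_norm f y h)\<^sup>2 = D2 y h h"
  by (simp only: local_norm_D2 real_sqrt_pow2[OF D2_nonneg])

lemma local_norm_nonneg: "local_norm f y h \<ge> 0"
  by (simp only: local_norm_D2 real_sqrt_ge_zero[OF D2_nonneg])

lemma local_norm_positive: "h \<noteq> 0 \<Longrightarrow> local_norm f y h > 0"
  unfolding local_norm_D2 by (intro real_sqrt_gt_zero D2_positive)

lemma local_norm_scaleR: "local_norm f y (c *\<^sub>R h) = \<bar>c\<bar> * local_norm f y h"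
proof -
  have "D2 y (c *\<^sub>R h) (c *\<^sub>R h) = c\<^sup>2 * D2 y h h"
    unfolding bilinear_lmul[OF bilinear_D2] bilinear_rmul[OF bilinear_D2]
    by (simp add: power2_eq_square)
  then show ?thesis
    by (simp only: local_norm_D2 real_sqrt_mult real_sqrt_abs)
qed

lemma local_norm_zero: "local_norm f y 0 = 0"
  using local_norm_scaleR[of y 0 0] by simp

lemma local_norm_minus: "local_norm f y (- h) = local_norm f y h"
  using local_norm_scaleR[of y "-1" h] by simp

lemma D2_Cauchy_Schwarz: "\<bar>D2 y u v\<bar> \<le> local_norm f y u * local_norm f y v"
proof -
  have "\<bar>D2 y u v\<bar> \<le> 1 * sqrt (D2 y u u) * sqrt (D2 y v v)"
    by (rule symmetric_bilinear_bound[OF bilinear_D2 D2_symmetric bilinear_D2])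
      (simp_all add: D2_positive D2_nonneg)
  then show ?thesis
    by (simp only: local_norm_D2 mult_1)
qed

lemma hessian_inverse: "hessian f y *v (matrix_inv (hessian f y) *v g) = g"
proof -
  have "v = 0" if "hessian f y *v v = 0" for v
  proof (rule ccontr)
    assume "v \<noteq> 0"
    then have "(hessian f y *v v) \<bullet> v > 0"
      unfolding hessian_inner by (rule D2_positive)
    then show False
      using that by simp
  qed
  then have "\<exists>B. B ** hessian f y = mat 1"
    by (simp only: matrix_left_invertible_ker) blast
  then have "invertible (hessian f y)"
    by (simp only: invertible_left_inverse)
  then have "hessian f y ** matrix_inv (hessian f y) = mat 1"
    unfolding invertible_def matrix_inv_def by (rule someI2_ex) blast
  then show ?thesis
    by (simp add: matrix_vector_mul_assoc)
qed

lemma dual_norm_local_norm: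
  "dual_norm f y g = local_norm f y (matrix_inv (hessian f y) *v g)"
  unfolding dual_norm_def local_norm_def hessian_inverse ..

lemma dual_norm_nonneg: "dual_norm f y g \<ge> 0"
  by (simp only: dual_norm_local_norm local_norm_nonneg)

lemma dual_norm_zero: "dual_norm f y 0 = 0"
  by (simp add: dual_norm_def)

lemma dual_norm_positive:
  assumes "g \<noteq> 0" shows "dual_norm f y g > 0"
proof -
  have "matrix_inv (hessian f y) *v g \<noteq> 0"
    using assms hessian_inverse[of y g] by force
  then show ?thesis
    unfolding dual_norm_local_norm by (rule local_norm_positive)
qed

text \<open>
  The next two facts characterise the dual norm of \<open>g\<close> as the least \<open>c\<close> with
  \<open>\<bar>g \<bullet> v\<bar> \<le> c * local_norm f y v\<close> for all \<open>v\<close>, a description free of inverse matrices.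
  The first is the Cauchy--Schwarz inequality for \<open>v\<close> and the preimage of \<open>g\<close> under the Hessian;
  the second tests the inequality on that preimage.
\<close>

lemma dual_norm_inner: "\<bar>g \<bullet> v\<bar> \<le> dual_norm f y g * local_norm f y v"
  using D2_Cauchy_Schwarz[of "matrix_inv (hessian f y) *v g" v y]
  by (simp only: hessian_inner[symmetric] hessian_inverse dual_norm_local_norm)

lemma dual_norm_least:
  assumes "\<And>v. \<bar>g \<bullet> v\<bar> \<le> c * local_norm f y v" and "c \<ge> 0"
  shows "dual_norm f y g \<le> c"
proof (cases "g = 0")
  case True
  then show ?thesis
    using assms by (simp add: dual_norm_zero)
next
  case False
  let ?w = "matrix_inv (hessian f y) *v g"
  have "(dual_norm f y g)\<^sup>2 = g \<bullet> ?w"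
    by (simp only: dual_norm_local_norm local_norm_power2 hessian_inner[symmetric] hessian_inverse)
  then have "dual_norm f y g * dual_norm f y g \<le> c * dual_norm f y g"
    using assms(1)[of ?w] by (simp only: power2_eq_square dual_norm_local_norm)
  then show ?thesis
    using dual_norm_positive[OF False, of y] by simp
qed

text \<open>
  Each coordinate of \<open>h\<close> is a linear functional, hence bounded by its dual norm.
\<close>

lemma norm_le_local_norm: "\<exists>C. \<forall>h::real ^ 'n. norm h \<le> C * local_norm f y h"
proof (intro exI allI)
  fix h :: "real ^ 'n"
  have "norm h \<le> (\<Sum>b\<in>Basis. \<bar>h \<bullet> b\<bar>)"
    by (rule norm_le_l1)
  also have "\<dots> \<le> (\<Sum>b\<in>Basis. dual_norm f y b * local_norm f y h)"
    by (intro sum_mono) (metis dual_norm_inner inner_commute)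
  finally show "norm h \<le> (\<Sum>b\<in>Basis. dual_norm f y b) * local_norm f y h"
    by (simp add: sum_distrib_right)
qed

text \<open>
  A supremum over an unbounded set of reals has no meaning, so boundedness comes first: multilinear
  forms are bounded in the Euclidean norm, which the local norm dominates. The inequality itself is
  homogeneity, also when some argument is zero.
\<close>

lemma op_norm_bound:
  assumes A: "multilinear_form p A" and len: "length hs = p"
  shows "\<bar>A hs\<bar> \<le> op_norm f y p A * prod_list (map (local_norm f y) hs)"
proof -
  let ?N = "local_norm f y"
  let ?S = "{hs. length hs = p \<and> (\<forall>h\<in>set hs. ?N h \<le> 1)}"
  obtain C where C: "\<And>h. norm h \<le> C * ?N h"
    using norm_le_local_norm by blast
  obtain B where B: "B \<ge> 0" "\<And>hs. length hs = p \<Longrightarrow> \<bar>A hs\<bar> \<le> B * prod_list (map norm hs)"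
    using multilinear_form_bounded[OF A] by blast
  have prod: "prod_list (map norm hs) \<le> \<bar>C\<bar> ^ length hs" if "\<forall>h\<in>set hs. ?N h \<le> 1" for hs
    using that
  proof (induction hs)
    case (Cons h hs)
    have "norm h \<le> \<bar>C\<bar>"
    proof -
      have "C * ?N h \<le> \<bar>C\<bar> * 1"
        using Cons.prems local_norm_nonneg[of y h] by (intro mult_mono) auto
      then show ?thesis
        using C[of h] by simp
    qed
    then show ?case
      using Cons by (auto intro!: mult_mono prod_list_nonneg)
  qed simp
  have bdd: "bdd_above ((\<lambda>hs. \<bar>A hs\<bar>) ` ?S)"
  proof (rule bdd_aboveI2)
    fix hs assume "hs \<in> ?S"
    then show "\<bar>A hs\<bar> \<le> B * \<bar>C\<bar> ^ p"
      using B prod[of hs] by (force intro: order_trans mult_left_mono)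
  qed
  have sup: "\<bar>A hs\<bar> \<le> op_norm f y p A" if "hs \<in> ?S" for hs
    unfolding op_norm_def by (rule cSUP_upper[OF that bdd])
  let ?unit = "\<lambda>h. h /\<^sub>R ?N h"
  have unit: "?N h *\<^sub>R ?unit h = h" for h
    using local_norm_positive[of h y] by (cases "h = 0") auto
  have nonneg: "prod_list (map ?N hs) \<ge> 0"
    by (intro prod_list_nonneg) (auto simp: local_norm_nonneg)
  have "A hs = A (map (\<lambda>h. ?N h *\<^sub>R ?unit h) hs)"
    unfolding unit by simp
  also have "\<dots> = prod_list (map ?N hs) * A (map ?unit hs)"
    by (rule multilinear_form_scale[OF A len])
  finally have "\<bar>A hs\<bar> = prod_list (map ?N hs) * \<bar>A (map ?unit hs)\<bar>"
    using nonneg by (simp add: abs_mult)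
  moreover have "map ?unit hs \<in> ?S"
  proof -
    have "?N (?unit h) \<le> 1" for h
      using local_norm_positive[of h y] less_imp_le[OF local_norm_positive[of h y]]
      by (cases "h = 0") (auto simp: local_norm_scaleR local_norm_zero)
    then show ?thesis
      using len by auto
  qed
  ultimately show ?thesis
    using mult_left_mono[OF sup[of "map ?unit hs"] nonneg] by (simp only: mult.commute)
qed

lemma holder_bound:
  assumes "holder_continuous p \<nu> L f" and len: "length hs = p"
  shows "\<bar>iter_deriv f hs x - iter_deriv f hs y\<bar>
    \<le> L * local_norm f x (x - y) powr \<nu> * prod_list (map (local_norm f x) hs)"
proof -
  let ?A = "\<lambda>hs. iter_deriv f hs x - iter_deriv f hs y"
  have diff: "times_differentiable p f"
    and op: "op_norm f x p ?A \<le> L * local_norm f x (x - y) powr \<nu>"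
    using assms(1) unfolding holder_continuous_def by auto
  have "multilinear_form p ?A"
    by (intro multilinear_form_diff multilinear_form_iter_deriv diff)
  then have "\<bar>?A hs\<bar> \<le> op_norm f x p ?A * prod_list (map (local_norm f x) hs)"
    using len by (rule op_norm_bound)
  also have "\<dots> \<le> L * local_norm f x (x - y) powr \<nu> * prod_list (map (local_norm f x) hs)"
    using op by (intro mult_right_mono prod_list_nonneg) (auto simp: local_norm_nonneg)
  finally show ?thesis .
qed

section \<open>One damped Newton step\<close>

text \<open>
  Since \<open>H d = - gradient f x / (1 + \<theta>)\<close>, the linear model of the gradient at \<open>x + d\<close> is
  \<open>\<theta> / (1 + \<theta>)\<close> times the old gradient. The hypothesis bounds the deviation from this model by
  \<open>\<theta>\<close> times the local norm of \<open>d\<close>, which is a term of the same size: this is the reason for the factor 2.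
\<close>

lemma damped_newton_step:
  fixes x :: "real ^ 'n" and \<theta> :: real
  defines "d \<equiv> - (1 / (1 + \<theta>)) *\<^sub>R (matrix_inv (hessian f x) *v gradient f x)"
  assumes \<theta>: "\<theta> \<ge> 0"
    and close: "\<And>t u v. 0 \<le> t \<Longrightarrow> t \<le> 1 \<Longrightarrow>
      \<bar>D2 (x + t *\<^sub>R d) u v - D2 x u v\<bar> \<le> \<theta> * (local_norm f x u * local_norm f x v)"
  shows damped_newton_residual:
      "dual_norm f x (gradient f (x + d)) \<le> 2 * \<theta> * dual_norm f x (gradient f x) / (1 + \<theta>)"
    and damped_newton_norm_change: "dual_norm f x g \<le> (1 + \<theta>) * dual_norm f (x + d) g"
proof -
  let ?g = "gradient f x" and ?G = "dual_norm f x (gradient f x)"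
  have d_norm: "local_norm f x d = ?G / (1 + \<theta>)"
    using \<theta> by (simp add: d_def local_norm_scaleR dual_norm_local_norm local_norm_minus)
  have d_D2: "D2 x d v = - (?g \<bullet> v) / (1 + \<theta>)" for v
    unfolding hessian_inner[symmetric] d_def scaleR_minus_left
    by (simp add: matrix_vector_mult_scaleR hessian_inverse linear_neg[OF matrix_vector_mul_linear])
  show "dual_norm f x (gradient f (x + d)) \<le> 2 * \<theta> * ?G / (1 + \<theta>)"
  proof (rule dual_norm_least)
    fix v
    \<comment> \<open>the intermediate point depends on \<open>v\<close>, which is harmless as the hypothesis is uniform in \<open>t\<close>\<close>
    obtain \<xi> where \<xi>: "0 < \<xi>" "\<xi> < 1"
      and mv: "iter_deriv f [v] (x + d) - iter_deriv f [v] x = D2 (x + \<xi> *\<^sub>R d) d v"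
      using line_mean_value[of "iter_deriv f [v]" x d]
        iter_deriv_differentiable[OF twice_differentiable, of "[v]"]
      by (auto simp: iter_deriv.simps(2)[of f d "[v]"])
    have eq: "gradient f (x + d) \<bullet> v
        = \<theta> / (1 + \<theta>) * (?g \<bullet> v) + (D2 (x + \<xi> *\<^sub>R d) d v - D2 x d v)"
    proof -
      have "\<theta> / (1 + \<theta>) * a + a / (1 + \<theta>) = a" for a
        using \<theta> by (simp add: add_divide_distrib[symmetric] field_simps)
      from this[of "?g \<bullet> v"] show ?thesis
        using mv unfolding gradient_inner[symmetric] d_D2 by simp
    qed
    have "\<bar>D2 (x + \<xi> *\<^sub>R d) d v - D2 x d v\<bar> \<le> \<theta> * (?G / (1 + \<theta>) * local_norm f x v)"
      using close[of \<xi> d v] \<xi> by (simp only: d_norm less_imp_le)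
    moreover have "\<bar>\<theta> / (1 + \<theta>) * (?g \<bullet> v)\<bar> \<le> \<theta> / (1 + \<theta>) * (?G * local_norm f x v)"
      using \<theta> dual_norm_inner[of ?g v x] by (simp add: abs_mult mult_left_mono divide_right_mono)
    moreover have "2 * \<theta> * ?G / (1 + \<theta>) * local_norm f x v
        = \<theta> / (1 + \<theta>) * (?G * local_norm f x v) + \<theta> * (?G / (1 + \<theta>) * local_norm f x v)"
      by (simp add: field_simps)
    ultimately show "\<bar>gradient f (x + d) \<bullet> v\<bar> \<le> 2 * \<theta> * ?G / (1 + \<theta>) * local_norm f x v"
      unfolding eq by linarith
  qed (use \<theta> dual_norm_nonneg in simp)
  show "dual_norm f x g \<le> (1 + \<theta>) * dual_norm f (x + d) g"
  proof (rule dual_norm_least)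
    fix v
    have "(local_norm f (x + d) v)\<^sup>2 \<le> (1 + \<theta>) * (local_norm f x v)\<^sup>2"
      using close[of 1 v v]
      unfolding local_norm_power2 by (simp add: local_norm_power2[symmetric] power2_eq_square algebra_simps)
    also have "\<dots> \<le> ((1 + \<theta>) * local_norm f x v)\<^sup>2"
      using \<theta> unfolding power_mult_distrib
      by (intro mult_right_mono) (simp_all add: power2_eq_square algebra_simps)
    finally have "local_norm f (x + d) v \<le> (1 + \<theta>) * local_norm f x v"
      by (rule power2_le_imp_le) (use \<theta> local_norm_nonneg in auto)
    then have "dual_norm f (x + d) g * local_norm f (x + d) v
        \<le> dual_norm f (x + d) g * ((1 + \<theta>) * local_norm f x v)"
      by (intro mult_left_mono dual_norm_nonneg)
    then show "\<bar>g \<bullet> v\<bar> \<le> (1 + \<theta>) * dual_norm f (x + d) g * local_norm f x v"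
      using dual_norm_inner[of g v "x + d"] by (simp add: mult_ac)
  qed (use \<theta> dual_norm_nonneg in simp)
qed

end

section \<open>The choice of the damping\<close>

text \<open>
  \<open>\<theta>\<close> is defined by \<open>\<theta> powr (1 + e) = 9 * L * G powr e\<close>. Replacing \<open>G\<close> by the length
  \<open>G / (1 + \<theta>)\<close> of the damped step divides both sides by \<open>(1 + \<theta>) powr e\<close>. The exponent \<open>e = q - 2\<close>
  is \<open>\<nu>\<close> for second order and \<open>1 + \<nu>\<close> for third order smoothness.
\<close>

lemma damped_radius:
  fixes L G \<theta> e :: real
  assumes "L > 0" "G > 0" "e \<ge> 0"
    and \<theta>_def: "\<theta> = (9 * L) powr (1 / (1 + e)) * G powr (e / (1 + e))"
  shows "9 * L * (G / (1 + \<theta>)) powr e = \<theta> * (\<theta> / (1 + \<theta>)) powr e"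
proof -
  have \<theta>: "\<theta> > 0"
    using assms by simp
  have "\<theta> powr (1 + e) = 9 * L * G powr e"
    using assms by (simp add: powr_mult powr_powr)
  then have "9 * L * G powr e = \<theta> * \<theta> powr e"
    using \<theta> by (simp add: powr_add)
  then show ?thesis
    using \<theta> \<open>G > 0\<close> by (simp add: powr_divide mult.assoc)
qed

lemma damped_radius_second_order:
  fixes L G \<theta> \<nu> :: real
  assumes "L \<ge> 0" "G > 0" "\<nu> \<ge> 0"
    and \<theta>_def: "\<theta> = (9 * L) powr (1 / (1 + \<nu>)) * G powr (\<nu> / (1 + \<nu>))"
  shows "L * (G / (1 + \<theta>)) powr \<nu> \<le> \<theta>"
proof (cases "L = 0")
  case True
  then show ?thesis
    by (simp add: \<theta>_def)
next
  case False
  have \<theta>: "\<theta> > 0"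
    using False assms by simp
  have "9 * L * (G / (1 + \<theta>)) powr \<nu> = \<theta> * (\<theta> / (1 + \<theta>)) powr \<nu>"
    using False \<open>L \<ge> 0\<close> by (intro damped_radius assms(2,3) \<theta>_def) simp
  moreover have "(\<theta> / (1 + \<theta>)) powr \<nu> \<le> 1 powr \<nu>"
    using \<theta> \<open>\<nu> \<ge> 0\<close> by (intro powr_mono2) auto
  then have "\<theta> * (\<theta> / (1 + \<theta>)) powr \<nu> \<le> \<theta>"
    using \<theta> by simp
  ultimately have "9 * (L * (G / (1 + \<theta>)) powr \<nu>) \<le> \<theta>"
    by (simp only: mult.assoc)
  moreover have "L * (G / (1 + \<theta>)) powr \<nu> \<ge> 0"
    using assms by simp
  ultimately show ?thesis
    by linarith
qed

text \<open>
  The left side is the bound of \<open>hessian_close_third_order\<close> for \<open>c = 3 / \<theta>\<close>. This choice makes the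
  first term exactly \<open>\<theta> / 3\<close>; by the previous identity the other two are then at most
  \<open>3 powr \<nu> * \<theta> / 9\<close> and \<open>\<theta> / 9\<close>, and the sum stays below \<open>\<theta>\<close>.
\<close>

lemma damped_radius_third_order:
  fixes L G \<theta> \<nu> :: real
  assumes "L > 0" "G > 0" "0 \<le> \<nu>" "\<nu> \<le> 1"
    and \<theta>_def: "\<theta> = (9 * L) powr (1 / (2 + \<nu>)) * G powr ((1 + \<nu>) / (2 + \<nu>))"
  defines "r \<equiv> G / (1 + \<theta>)"
  shows "\<theta> / 3 + L * (3 / \<theta> * r) powr \<nu> * r + L * r powr \<nu> * r \<le> \<theta>"
proof -
  have \<theta>: "\<theta> > 0"
    using assms by simp
  have r: "r > 0"
    unfolding r_def using \<theta> \<open>G > 0\<close> by simp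
  have rad: "9 * (L * r powr \<nu> * r) = \<theta> * (\<theta> / (1 + \<theta>)) powr (1 + \<nu>)"
  proof -
    have two: "1 + (1 + \<nu>) = 2 + \<nu>"
      by simp
    have "9 * L * r powr (1 + \<nu>) = \<theta> * (\<theta> / (1 + \<theta>)) powr (1 + \<nu>)"
      unfolding r_def using \<open>\<nu> \<ge> 0\<close>
      by (intro damped_radius assms(1,2)) (simp, simp only: two, rule \<theta>_def)
    moreover have "9 * L * r powr (1 + \<nu>) = 9 * (L * r powr \<nu> * r)"
      using r by (simp add: powr_add)
    ultimately show ?thesis
      by simp
  qed
  have "(\<theta> / (1 + \<theta>)) powr (1 + \<nu>) \<le> 1 powr (1 + \<nu>)"
    using \<theta> \<open>\<nu> \<ge> 0\<close> by (intro powr_mono2) auto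
  then have a: "9 * (L * r powr \<nu> * r) \<le> \<theta>"
    unfolding rad using \<theta> by simp
  have "(\<theta> / (1 + \<theta>)) powr (1 + \<nu>) = \<theta> / (1 + \<theta>) * (\<theta> / (1 + \<theta>)) powr \<nu>"
    using \<theta> by (simp add: powr_add)
  also have "\<dots> \<le> 1 * \<theta> powr \<nu>"
    using \<theta> \<open>\<nu> \<ge> 0\<close> by (intro mult_mono powr_mono2) (auto simp: field_simps)
  finally have b: "9 * (L * r powr \<nu> * r) \<le> \<theta> * \<theta> powr \<nu>"
    unfolding rad using \<theta> by simp
  have "(3 / \<theta> * r) powr \<nu> = 3 powr \<nu> * r powr \<nu> / \<theta> powr \<nu>"
    using \<theta> r by (simp add: powr_mult powr_divide)
  then have "9 * (L * (3 / \<theta> * r) powr \<nu> * r) = 3 powr \<nu> * (9 * (L * r powr \<nu> * r) / \<theta> powr \<nu>)"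
    by simp
  also have "\<dots> \<le> 3 powr 1 * \<theta>"
    using b \<theta> \<open>\<nu> \<le> 1\<close> \<open>L > 0\<close> r by (intro mult_mono powr_mono) (auto simp: field_simps)
  finally have c: "9 * (L * (3 / \<theta> * r) powr \<nu> * r) \<le> 3 powr 1 * \<theta>" .
  have three: "(3 :: real) powr 1 = 3"
    by simp
  show ?thesis
    using a c[unfolded three] \<theta> by linarith
qed

section \<open>Change of the Hessian along a step\<close>

context hessian_metric
begin

lemma holder_constant_nonneg:
  assumes "holder_continuous p \<nu> L f"
  shows "L \<ge> 0"
proof -
  define h :: "real ^ 'n" where "h = axis undefined 1"
  have "h \<noteq> 0"
    by (simp add: h_def axis_eq_0_iff)
  then have h: "local_norm f h h > 0"
    by (rule local_norm_positive)
  then have pos: "local_norm f h h powr \<nu> * local_norm f h h ^ p > 0"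
    by (intro mult_pos_pos) simp_all
  have "0 \<le> L * (local_norm f h h powr \<nu> * local_norm f h h ^ p)"
    using holder_bound[OF assms, of "replicate p h" h 0] by (simp add: mult.assoc)
  then show ?thesis
    using pos by (simp only: zero_le_mult_iff not_le[symmetric]) blast
qed

lemma hessian_close_second_order:
  assumes "holder_continuous 2 \<nu> L f" and "\<nu> \<ge> 0" and t: "0 \<le> t" "t \<le> 1"
  shows "\<bar>D2 (x + t *\<^sub>R d) u v - D2 x u v\<bar>
    \<le> L * local_norm f x d powr \<nu> * (local_norm f x u * local_norm f x v)"
proof -
  have "local_norm f x (x - (x + t *\<^sub>R d)) \<le> local_norm f x d"
    using t local_norm_nonneg[of x d]
    by (simp add: local_norm_minus local_norm_scaleR mult_left_le_one_le)
  then have "local_norm f x (x - (x + t *\<^sub>R d)) powr \<nu> \<le> local_norm f x d powr \<nu>"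
    using \<open>\<nu> \<ge> 0\<close> by (intro powr_mono2 local_norm_nonneg)
  then have "L * local_norm f x (x - (x + t *\<^sub>R d)) powr \<nu> \<le> L * local_norm f x d powr \<nu>"
    using holder_constant_nonneg[OF assms(1)] by (rule mult_left_mono)
  moreover have "\<bar>D2 x u v - D2 (x + t *\<^sub>R d) u v\<bar>
      \<le> L * local_norm f x (x - (x + t *\<^sub>R d)) powr \<nu> * (local_norm f x u * local_norm f x v)"
    using holder_bound[OF assms(1), of "[u, v]" x "x + t *\<^sub>R d"] by simp
  ultimately show ?thesis
    using mult_right_mono[of _ _ "local_norm f x u * local_norm f x v"] local_norm_nonneg
    by (smt (verit) mult_nonneg_nonneg)
qed

abbreviation D3 :: "real ^ 'n \<Rightarrow> real ^ 'n \<Rightarrow> real ^ 'n \<Rightarrow> real ^ 'n \<Rightarrow> real" where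
  "D3 y w u v \<equiv> iter_deriv f [w, u, v] y"

text \<open>
  By the mean value theorem the change of the Hessian is the third derivative at an intermediate
  point, which the Hoelder condition compares with the one at \<open>x\<close>.
\<close>

lemma hessian_change_third_order:
  assumes "holder_continuous 3 \<nu> L f" and "\<nu> \<ge> 0"
  shows "\<bar>D2 (x + h) u v - D2 x u v - D3 x h u v\<bar>
    \<le> L * local_norm f x h powr \<nu> * local_norm f x h * (local_norm f x u * local_norm f x v)"
proof -
  let ?N = "local_norm f x"
  have diff: "times_differentiable 3 f"
    using assms(1) by (simp add: holder_continuous_def)
  obtain \<xi> where \<xi>: "0 < \<xi>" "\<xi> < 1" and mv: "D2 (x + h) u v - D2 x u v = D3 (x + \<xi> *\<^sub>R h) h u v"
    using line_mean_value[of "iter_deriv f [u, v]" x h]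
      iter_deriv_differentiable[OF diff, of "[u, v]"]
    by (auto simp: iter_deriv.simps(2)[of f h "[u, v]"])
  have "?N (x - (x + \<xi> *\<^sub>R h)) \<le> ?N h"
    using \<xi> local_norm_nonneg[of x h]
    by (simp add: local_norm_minus local_norm_scaleR mult_left_le_one_le)
  then have "?N (x - (x + \<xi> *\<^sub>R h)) powr \<nu> \<le> ?N h powr \<nu>"
    using \<open>\<nu> \<ge> 0\<close> by (intro powr_mono2 local_norm_nonneg)
  then have "L * ?N (x - (x + \<xi> *\<^sub>R h)) powr \<nu> \<le> L * ?N h powr \<nu>"
    using holder_constant_nonneg[OF assms(1)] by (rule mult_left_mono)
  then have "L * ?N (x - (x + \<xi> *\<^sub>R h)) powr \<nu> * (?N h * (?N u * ?N v))
      \<le> L * ?N h powr \<nu> * (?N h * (?N u * ?N v))"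
    by (intro mult_right_mono mult_nonneg_nonneg local_norm_nonneg)
  moreover have "\<bar>D3 x h u v - D3 (x + \<xi> *\<^sub>R h) h u v\<bar>
      \<le> L * ?N (x - (x + \<xi> *\<^sub>R h)) powr \<nu> * (?N h * (?N u * ?N v))"
    using holder_bound[OF assms(1), of "[h, u, v]" x "x + \<xi> *\<^sub>R h"] by simp
  ultimately show ?thesis
    unfolding mv by (simp only: mult.assoc)
qed

lemma D3_scaleR:
  assumes "times_differentiable 3 f"
  shows "D3 x (c *\<^sub>R h) u v = c * D3 x h u v"
  using linear_cmul[OF linear_frechet_derivative[OF iter_deriv_differentiable[OF assms, of "[u, v]"]]]
  by (simp add: iter_deriv.simps(2)[of f _ "[u, v]"])

lemma bilinear_D3:
  assumes "times_differentiable 3 f"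
  shows "bilinear (D3 x h)"
  using multilinear_form_iter_deriv[OF assms, of x]
  by (simp add: numeral_3_eq_3 bilinear_def)

lemma D3_symmetric: "D3 x h u v = D3 x h v u"
proof -
  have "iter_deriv f [u, v] = iter_deriv f [v, u]"
    using D2_symmetric by blast
  then show ?thesis
    by (simp only: iter_deriv.simps(2)[of f h])
qed

text \<open>
  The Hessian at \<open>x + h\<close> is positive, so \<open>- D3 x h v v\<close> cannot exceed \<open>D2 x v v\<close> plus the remainder
  of the first order expansion; replacing \<open>h\<close> by \<open>- h\<close> bounds the other sign, and polarization
  passes from \<open>v, v\<close> to \<open>u, v\<close>. The left side is linear in \<open>h\<close> but the right side is not, so scaling \<open>h\<close>
  gives a whole family of bounds.
\<close>

lemma third_derivative_bound:
  assumes holder: "holder_continuous 3 \<nu> L f" and \<nu>: "\<nu> \<ge> 0"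
  shows "\<bar>D3 x h u v\<bar> \<le> (1 + L * local_norm f x h powr \<nu> * local_norm f x h)
    * local_norm f x u * local_norm f x v"
proof -
  let ?N = "local_norm f x"
  have diff: "times_differentiable 3 f"
    using holder by (simp add: holder_continuous_def)
  have one_sided: "- D3 x h v v \<le> (1 + L * ?N h powr \<nu> * ?N h) * D2 x v v" for h v
  proof -
    have "\<bar>D2 (x + h) v v - D2 x v v - D3 x h v v\<bar> \<le> L * ?N h powr \<nu> * ?N h * D2 x v v"
      using hessian_change_third_order[OF holder \<nu>, where x = x and h = h and u = v and v = v]
      by (simp only: power2_eq_square[symmetric] local_norm_power2)
    then show ?thesis
      using D2_nonneg[of v "x + h"] by (simp add: algebra_simps)
  qed
  have "\<bar>D3 x h v v\<bar> \<le> (1 + L * ?N h powr \<nu> * ?N h) * D2 x v v" for v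
    using one_sided[of h v] one_sided[of "- h" v] D3_scaleR[OF diff, where c = "-1" and h = h]
    by (simp add: local_norm_minus)
  then show ?thesis
    unfolding local_norm_D2[of x u] local_norm_D2[of x v]
    by (intro symmetric_bilinear_bound[OF bilinear_D3[OF diff] D3_symmetric bilinear_D2] D2_positive)
qed

text \<open>
  The parameter \<open>c\<close> is the scale at which the bound on the third derivative is applied, to
  \<open>c *\<^sub>R d\<close> instead of \<open>d\<close>: a large \<open>c\<close> reduces the constant term \<open>1\<close> of that bound to
  \<open>1 / c\<close> and inflates the Hoelder term.
\<close>

lemma hessian_close_third_order:
  fixes x d u v :: "real ^ 'n"
  assumes holder: "holder_continuous 3 \<nu> L f" and \<nu>: "\<nu> \<ge> 0"
    and t: "0 \<le> t" "t \<le> 1" and c: "c > 0"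
  defines "r \<equiv> local_norm f x d"
  shows "\<bar>D2 (x + t *\<^sub>R d) u v - D2 x u v\<bar>
    \<le> (1 / c + L * (c * r) powr \<nu> * r + L * r powr \<nu> * r) * (local_norm f x u * local_norm f x v)"
proof -
  let ?N = "local_norm f x"
  let ?uv = "?N u * ?N v"
  have L: "L \<ge> 0"
    by (rule holder_constant_nonneg[OF holder])
  have diff: "times_differentiable 3 f"
    using holder by (simp add: holder_continuous_def)
  have uv: "?uv \<ge> 0" and r: "r \<ge> 0"
    by (simp_all add: local_norm_nonneg r_def)
  have td: "?N (t *\<^sub>R d) \<le> r" "?N (t *\<^sub>R d) \<ge> 0"
    using t r by (simp_all add: local_norm_scaleR r_def[symmetric] mult_left_le_one_le)
  have "L * ?N (t *\<^sub>R d) powr \<nu> * ?N (t *\<^sub>R d) \<le> L * r powr \<nu> * r"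
    using td L \<nu> r by (intro mult_mono powr_mono2) auto
  then have rest: "\<bar>D2 (x + t *\<^sub>R d) u v - D2 x u v - D3 x (t *\<^sub>R d) u v\<bar> \<le> L * r powr \<nu> * r * ?uv"
    using hessian_change_third_order[OF holder \<nu>, where x = x and h = "t *\<^sub>R d" and u = u and v = v] mult_right_mono[OF _ uv]
    by (meson order_trans)
  have "c * \<bar>D3 x d u v\<bar> \<le> (1 + L * (c * r) powr \<nu> * (c * r)) * ?uv"
    using third_derivative_bound[OF holder \<nu>, where x = x and h = "c *\<^sub>R d" and u = u and v = v] c
    by (simp add: D3_scaleR[OF diff] local_norm_scaleR abs_mult r_def mult.assoc)
  then have "\<bar>D3 x d u v\<bar> \<le> (1 / c + L * (c * r) powr \<nu> * r) * ?uv"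
    using c by (simp add: field_simps)
  moreover have "\<bar>D3 x (t *\<^sub>R d) u v\<bar> \<le> \<bar>D3 x d u v\<bar>"
    using t by (simp add: D3_scaleR[OF diff] abs_mult mult_left_le_one_le)
  ultimately show ?thesis
    using rest by (simp add: distrib_right)
qed

text \<open>
  This is where the damping of the algorithm meets the smoothness of \<open>f\<close>. For \<open>G > 0\<close> and \<open>L > 0\<close>
  the arithmetic of the choice of \<open>\<theta>\<close> applies. The degenerate cases need separate arguments because \<open>\<theta>\<close> may vanish: \<open>G = 0\<close> gives \<open>d = 0\<close>, and
  for \<open>L = 0\<close> and \<open>p = 3\<close> letting the scale \<open>c\<close> grow shows that the Hessian is constant along the step.
\<close>

lemma hessian_close_newton_step:
  assumes p: "p \<in> {2, 3}" and \<nu>: "\<nu> \<in> {0..1}" and holder: "holder_continuous p \<nu> L f"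
    and q: "q = real p + \<nu>" and t: "0 \<le> t" "t \<le> 1"
    and d: "local_norm f x d = dual_norm f x (gradient f x) / (1 + RN_theta q L f x)"
  shows "\<bar>D2 (x + t *\<^sub>R d) u v - D2 x u v\<bar>
    \<le> RN_theta q L f x * (local_norm f x u * local_norm f x v)"
proof -
  define \<theta> G where "\<theta> = RN_theta q L f x" and "G = dual_norm f x (gradient f x)"
  have L: "L \<ge> 0"
    by (rule holder_constant_nonneg[OF holder])
  have uv: "local_norm f x u * local_norm f x v \<ge> 0"
    by (simp add: local_norm_nonneg)
  have r: "local_norm f x d = G / (1 + \<theta>)"
    using d by (simp add: \<theta>_def G_def)
  have \<theta>: "\<theta> = (9 * L) powr (1 / (q - 1)) * G powr ((q - 2) / (q - 1))"
    by (simp add: \<theta>_def G_def RN_theta_def)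
  then have "\<theta> \<ge> 0"
    using L by simp
  consider "G = 0" | "G > 0" "p = 2" | "G > 0" "p = 3" "L = 0" | "G > 0" "p = 3" "L > 0"
    using p L dual_norm_nonneg[of x "gradient f x"] G_def by fastforce
  then have "\<bar>D2 (x + t *\<^sub>R d) u v - D2 x u v\<bar> \<le> \<theta> * (local_norm f x u * local_norm f x v)"
  proof cases
    case 1
    then have "d = 0"
      using r local_norm_positive[of d x] by auto
    then show ?thesis
      using \<open>\<theta> \<ge> 0\<close> uv by simp
  next
    case 2
    have "L * local_norm f x d powr \<nu> \<le> \<theta>"
      using damped_radius_second_order[of L G \<nu> \<theta>] L 2 \<nu> \<theta> q r by simp
    moreover have "\<bar>D2 (x + t *\<^sub>R d) u v - D2 x u v\<bar>
        \<le> L * local_norm f x d powr \<nu> * (local_norm f x u * local_norm f x v)"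
      using holder \<nu> t 2 by (intro hessian_close_second_order) auto
    ultimately show ?thesis
      using mult_right_mono[OF _ uv] by (meson order_trans)
  next
    case 3
    let ?uv = "local_norm f x u * local_norm f x v"
    \<comment> \<open>the Hoelder terms vanish and the bound at scale \<open>c\<close> is \<open>?uv / c\<close>; adding 1 covers \<open>?uv = 0\<close>\<close>
    have "\<bar>D2 (x + t *\<^sub>R d) u v - D2 x u v\<bar> \<le> 0 + e" if "e > 0" for e
    proof -
      have c: "(?uv + 1) / e > 0"
        using that uv by (simp add: add_nonneg_pos)
      have "\<bar>D2 (x + t *\<^sub>R d) u v - D2 x u v\<bar> \<le> 1 / ((?uv + 1) / e) * ?uv"
        using hessian_close_third_order[OF holder[unfolded 3] _ t c, where x = x and d = d and u = u and v = v] \<nu> by simp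
      also have "\<dots> = e * (?uv / (?uv + 1))"
        by simp
      also have "\<dots> \<le> e * 1"
        using that uv by (intro mult_left_mono) (auto simp: divide_le_eq_1)
      finally show ?thesis
        by simp
    qed
    then have "\<bar>D2 (x + t *\<^sub>R d) u v - D2 x u v\<bar> \<le> 0"
      by (rule field_le_epsilon)
    then show ?thesis
      using \<open>\<theta> \<ge> 0\<close> uv by (simp add: mult_nonneg_nonneg order_trans)
  next
    case 4
    have "\<theta> > 0"
      using \<theta> 4 by simp
    let ?r = "local_norm f x d"
    have "1 / (3 / \<theta>) + L * (3 / \<theta> * ?r) powr \<nu> * ?r + L * ?r powr \<nu> * ?r \<le> \<theta>"
      using damped_radius_third_order[of L G \<nu> \<theta>] 4 \<nu> \<theta> q r by simp
    moreover have "\<bar>D2 (x + t *\<^sub>R d) u v - D2 x u v\<bar>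
      \<le> (1 / (3 / \<theta>) + L * (3 / \<theta> * ?r) powr \<nu> * ?r + L * ?r powr \<nu> * ?r)
          * (local_norm f x u * local_norm f x v)"
      using hessian_close_third_order[OF holder[unfolded 4(2)] _ t,
        where c = "3 / \<theta>" and x = x and d = d and u = u and v = v] \<nu> \<open>\<theta> > 0\<close>
      by simp
    ultimately show ?thesis
      using mult_right_mono[OF _ uv] by (meson order_trans)
  qed
  then show ?thesis
    by (simp add: \<theta>_def)
qed

end

section \<open>Superlinear convergence\<close>

text \<open>
  The two factors of \<open>a * (a / b)\<close>, for the dual norms \<open>a\<close> at \<open>x k\<close> and \<open>b\<close> at \<open>x (Suc k)\<close> of the
  new gradient, are bounded by the two conclusions of \<open>damped_newton_step\<close>; the factor
  \<open>1 + \<theta>\<close> cancels.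
\<close>

theorem theorem3:
  fixes f :: "real ^ 'n \<Rightarrow> real" and x0 :: "real ^ 'n"
    and p :: nat and \<nu> q L M \<gamma> :: real and x :: "nat \<Rightarrow> real ^ 'n"
  assumes "times_differentiable 2 f"
    and "\<forall>z. positive_definite (hessian f z)"
    and "convex_on UNIV f"
    and "p \<in> {2, 3}" and "\<nu> \<in> {0..1}"
    and "holder_continuous p \<nu> L f"
    and "q = real p + \<nu>" and "M = L"
    and "x = RN q M f x0"
    and "bounded_hessian_change \<gamma> f x"
  shows "\<forall>k. dual_norm f (x (Suc k)) (gradient f (x (Suc k)))
           \<le> 2 / \<gamma> * (9 * M) powr (1 / (q - 1))
               * dual_norm f (x k) (gradient f (x k)) powr (2 - 1 / (q - 1))"
proof
  fix k
  interpret hessian_metric f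
    using assms(1,2) by unfold_locales auto
  define y g \<theta> G where "y = x k" and "g = gradient f (x (Suc k))"
    and "\<theta> = RN_theta q L f y" and "G = dual_norm f y (gradient f y)"
  let ?d = "- (1 / (1 + \<theta>)) *\<^sub>R (matrix_inv (hessian f y) *v gradient f y)"
  have q: "q \<ge> 2"
    using assms(4,5,7) by auto
  have \<theta>: "\<theta> \<ge> 0"
    using holder_constant_nonneg[OF assms(6)] by (simp add: \<theta>_def RN_theta_def)
  have G: "G \<ge> 0"
    unfolding G_def by (rule dual_norm_nonneg)
  have step: "x (Suc k) = y + ?d"
    by (simp add: assms(8,9) y_def \<theta>_def RN_alpha_def)
  have d_norm: "local_norm f y ?d = G / (1 + \<theta>)"
    using \<theta> by (simp add: local_norm_minus local_norm_scaleR dual_norm_local_norm G_def)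
  have close: "\<bar>D2 (y + t *\<^sub>R ?d) u v - D2 y u v\<bar> \<le> \<theta> * (local_norm f y u * local_norm f y v)"
    if "0 \<le> t" "t \<le> 1" for t u v
    using hessian_close_newton_step[OF assms(4,5,6,7) that d_norm[unfolded \<theta>_def G_def]]
    by (simp only: \<theta>_def)
  have residual: "dual_norm f y g \<le> 2 * \<theta> * G / (1 + \<theta>)"
    using damped_newton_residual[OF \<theta> close] by (simp add: g_def step G_def)
  have change: "dual_norm f y g \<le> (1 + \<theta>) * dual_norm f (x (Suc k)) g"
    using damped_newton_norm_change[OF \<theta> close] by (simp only: step)
  have \<gamma>: "\<gamma> > 0"
    using assms(10) by (simp add: bounded_hessian_change_def)
  have "\<gamma> * dual_norm f (x (Suc k)) g \<le> 2 * \<theta> * G"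
  proof (cases "g = 0")
    case True
    then show ?thesis
      using \<theta> G by (simp add: dual_norm_zero)
  next
    case False
    let ?a = "dual_norm f y g" and ?b = "dual_norm f (x (Suc k)) g"
    have b: "?b > 0"
      by (rule dual_norm_positive[OF False])
    have "\<gamma> \<le> ?a\<^sup>2 / ?b\<^sup>2"
      using assms(10) False by (simp add: bounded_hessian_change_def g_def y_def)
    then have "\<gamma> * ?b \<le> ?a * (?a / ?b)"
      using b by (simp add: field_simps power2_eq_square)
    also have "\<dots> \<le> (2 * \<theta> * G / (1 + \<theta>)) * (1 + \<theta>)"
      using residual change b \<theta> G dual_norm_nonneg[of y g]
      by (intro mult_mono) (auto simp: pos_divide_le_eq)
    also have "\<dots> = 2 * \<theta> * G"
      using \<theta> by simp
    finally show ?thesis .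
  qed
  then have "dual_norm f (x (Suc k)) g \<le> 2 * \<theta> * G / \<gamma>"
    using \<gamma> by (simp add: pos_le_divide_eq mult.commute)
  also have "\<theta> * G = (9 * M) powr (1 / (q - 1)) * G powr (2 - 1 / (q - 1))"
  proof -
    have "(q - 2) / (q - 1) + 1 = 2 - 1 / (q - 1)"
      using q by (simp add: field_simps)
    then have "G powr (2 - 1 / (q - 1)) = G powr ((q - 2) / (q - 1)) * G"
      using G powr_add[of G "(q - 2) / (q - 1)" 1] by simp
    then show ?thesis
      by (simp add: \<theta>_def G_def RN_theta_def assms(8))
  qed
  then have "2 * \<theta> * G / \<gamma> = 2 / \<gamma> * (9 * M) powr (1 / (q - 1)) * G powr (2 - 1 / (q - 1))"
    by simp
  finally show "dual_norm f (x (Suc k)) (gradient f (x (Suc k)))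
      \<le> 2 / \<gamma> * (9 * M) powr (1 / (q - 1))
          * dual_norm f (x k) (gradient f (x k)) powr (2 - 1 / (q - 1))"
    by (simp only: g_def G_def y_def)
qed

end
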